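(* Let $V(\tilde\Lambda)$ be a finite-dimensional irreducible $gl(m|n+1)$-module with highest weight $\tilde\Lambda=\sum_{i=1}^m\tilde\Lambda_i\varepsilon_i+\sum_{\mu=1}^{n+1}\tilde\Lambda_\mu\delta_\mu$. Let $v_+\in V(\tilde\Lambda)$ be a (nonzero) $L$-maximal weight vector whose weight, restricted to the Cartan subalgebra of $gl(m|n)$, is $\Lambda=\sum_{i=1}^m\Lambda_i\varepsilon_i+\sum_{\mu=1}^n\Lambda_\mu\delta_\mu$. Then: (i) the components of $\Lambda$ satisfy the betweenness conditions $\tilde\Lambda_\mu\ge\Lambda_\mu\ge\tilde\Lambda_{\mu+1}$ for $1\le\mu\le n$, and $\tilde\Lambda_i\ge\Lambda_i\ge\tilde\Lambda_i-1$ for $1\le i\le m$; (ii) $v_+$ is the unique (up to scalar multiples) $L$-maximal weight vector in $V(\tilde\Lambda)$ of weight $\Lambda$.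
   Context: Work over $\mathbb{C}$. $gl(m|n+1)$ has homogeneous basis $E_{pq}$, $1\le p,q\le m+n+1$, with parity $(p)+(q)$ where $(p)=0$ for $p\le m$ and $(p)=1$ for $p>m$, and graded bracket $[E_{pq},E_{rs}]=\delta_{qr}E_{ps}-(-1)^{((p)+(q))((r)+(s))}\delta_{ps}E_{rq}$. Weights are written in the basis $\varepsilon_i$ ($1\le i\le m$), $\delta_\mu$: the coefficient of $\varepsilon_i$ is the eigenvalue of $E_{ii}$ and the coefficient of $\delta_\mu$ is the eigenvalue of $E_{m+\mu,m+\mu}$. $gl(m|n)$ is the subalgebra spanned by $E_{pq}$ with $p,q\le m+n$, and $L=gl(m|n)\oplus gl(1)$ where $gl(1)$ is spanned by $E_{m+n+1,m+n+1}$. An $L$-maximal weight vector is a weight vector annihilated by all $E_{pq}$ with $p<q\le m+n$. (All weight components of $V(\tilde\Lambda)$ differ from those of $\tilde\Lambda$ by integers, so the inequalities compare numbers differing by integers.) *)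

theory Defs
  imports "HOL-Analysis.Analysis"
begin

(* A finite-dimensional representation of gl(m|n+1) on complex^'d is given by the
   matrices rho p q representing the basis elements E_pq, 1 <= p,q <= m+n+1.
   Linearity in the algebra element is implicit (extend linearly from the basis). *)

definition par :: "nat \<Rightarrow> nat \<Rightarrow> nat" where
  "par m p = (if p \<le> m then 0 else 1)"

definition ssign :: "nat \<Rightarrow> nat \<Rightarrow> nat \<Rightarrow> nat \<Rightarrow> nat \<Rightarrow> complex" where
  "ssign m p q r s = (-1) ^ ((par m p + par m q) * (par m r + par m s))"

(* rho respects the graded bracket
   [E_pq,E_rs] = delta_qr E_ps - (-1)^(((p)+(q))((r)+(s))) delta_ps E_rq *)
definition is_gl_rep :: "nat \<Rightarrow> nat \<Rightarrow> (nat \<Rightarrow> nat \<Rightarrow> complex^'d^'d) \<Rightarrow> bool" where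
  "is_gl_rep m N rho \<longleftrightarrow>
     (\<forall>p\<in>{1..N}. \<forall>q\<in>{1..N}. \<forall>r\<in>{1..N}. \<forall>s\<in>{1..N}. \<forall>x.
        rho p q *v (rho r s *v x) - ssign m p q r s *s (rho r s *v (rho p q *v x))
        = (if q = r then rho p s *v x else 0) - ssign m p q r s *s (if p = s then rho r q *v x else 0))"

definition csubspace :: "(complex^'d) set \<Rightarrow> bool" where
  "csubspace W \<longleftrightarrow> 0 \<in> W \<and> (\<forall>x\<in>W. \<forall>y\<in>W. x + y \<in> W) \<and> (\<forall>c. \<forall>x\<in>W. c *s x \<in> W)"

definition irreducible_rep :: "nat \<Rightarrow> (nat \<Rightarrow> nat \<Rightarrow> complex^'d^'d) \<Rightarrow> bool" where
  "irreducible_rep N rho \<longleftrightarrow>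
     (\<forall>W. csubspace W \<and> (\<forall>p\<in>{1..N}. \<forall>q\<in>{1..N}. \<forall>x\<in>W. rho p q *v x \<in> W)
          \<longrightarrow> W = {0} \<or> W = UNIV)"

definition highest_weight_vector :: "nat \<Rightarrow> (nat \<Rightarrow> nat \<Rightarrow> complex^'d^'d) \<Rightarrow> (nat \<Rightarrow> complex) \<Rightarrow> complex^'d \<Rightarrow> bool" where
  "highest_weight_vector N rho Lt v \<longleftrightarrow> v \<noteq> 0 \<and>
     (\<forall>p\<in>{1..N}. rho p p *v v = Lt p *s v) \<and>
     (\<forall>p\<in>{1..N}. \<forall>q\<in>{1..N}. p < q \<longrightarrow> rho p q *v v = 0)"

definition L_maximal_of_weight :: "nat \<Rightarrow> nat \<Rightarrow> (nat \<Rightarrow> nat \<Rightarrow> complex^'d^'d) \<Rightarrow> (nat \<Rightarrow> complex) \<Rightarrow> complex^'d \<Rightarrow> bool" where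
  "L_maximal_of_weight m n rho Lam v \<longleftrightarrow> v \<noteq> 0 \<and>
     (\<forall>p\<in>{1..m+n+1}. \<exists>c. rho p p *v v = c *s v) \<and>
     (\<forall>p\<in>{1..m+n}. rho p p *v v = Lam p *s v) \<and>
     (\<forall>p\<in>{1..m+n}. \<forall>q\<in>{1..m+n}. p < q \<longrightarrow> rho p q *v v = 0)"

(* a \<ge> b for complex numbers differing by an integer: a - b is a nonnegative integer *)
definition cge :: "complex \<Rightarrow> complex \<Rightarrow> bool" where
  "cge a b \<longleftrightarrow> a - b \<in> \<nat>"

end

theory Submission
  imports Defs
begin

text \<open>
  Write \<open>N = m + n + 1\<close>. Exhausting the root vectors \<open>E\<^sub>1\<^sub>N\<close>, \<open>E\<^sub>2\<^sub>N\<close> and so on up to \<open>E\<^sub>p\<^sub>N\<close> with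
  \<open>p = m + n\<close> on an \<open>L\<close>-maximal vector \<open>v\<close>, in this order and each to its largest power that does
  not annihilate, leads to a highest weight vector of the whole algebra, which is unique up to
  scalars. The exponents are therefore the differences of the components of the two weights; the
  exponents of the odd root vectors are at most 1. As the exponents depend on the weight of \<open>v\<close> only,
  this is one injective linear map from the \<open>L\<close>-maximal vectors of a given weight to a line.

  For the remaining inequality, exhaust only the odd \<open>E\<^sub>i\<^sub>N\<close> and then the \<open>E\<^sub>N\<^sub>q\<close> for \<open>q\<close> from \<open>m + n\<close> down
  to \<open>m + 1\<close>. The result is a highest weight vector for the ordering that has \<open>N\<close> directly after \<open>m\<close>,
  and \<open>n\<close> simple \<open>sl\<^sub>2\<close>-reflections relate its weight to the highest weight by a cyclic shift.
\<close>

section \<open>Eigenvectors in finite dimension\<close>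

text \<open>A finite product of factors \<open>A - t\<close> with \<open>t\<close> in
  \<open>\<Theta>\<close> annihilates \<open>x\<close>, yet multiplies the eigenvector
  \<open>x\<close> by the product of the numbers \<open>\<theta> - t\<close>; so one of these is
  0.\<close>

lemma eigenvalue_of_span_of_eigenvectors:
  fixes A :: "complex^'d^'d"
  assumes x: "x \<in> vec.span S" "x \<noteq> 0" "A *v x = \<theta> *s x"
    and S: "\<And>s. s \<in> S \<Longrightarrow> \<exists>t\<in>\<Theta>. A *v s = t *s s"
  shows "\<theta> \<in> \<Theta>"
proof -
  define ann where "ann ts y = foldr (\<lambda>t z. A *v z - t *s z) ts y" for ts and y :: "complex^'d"
  have ann_Nil: "ann [] y = y" and ann_Cons: "ann (t # ts) y = A *v ann ts y - t *s ann ts y" for t ts y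
    by (simp_all add: ann_def)
  have ann_add: "ann ts (c *s y + z) = c *s ann ts y + ann ts z" for ts c y z
    by (induction ts)
      (simp_all add: ann_Nil ann_Cons vec.add vec.scale vec.scale_right_distrib
        vec.scale_right_diff_distrib mult.commute)
  have ann_eigen: "ann ts y = (\<Prod>u\<leftarrow>ts. t - u) *s y" if "A *v y = t *s y" for ts t y
    by (induction ts)
      (simp_all add: ann_Nil ann_Cons vec.scale that vec.scale_left_diff_distrib algebra_simps)
  have "\<exists>ts. set ts \<subseteq> \<Theta> \<and> ann ts x = 0"
    using x(1)
  proof (induction rule: vec.span_induct_alt)
    case base
    show ?case by (rule exI[of _ "[]"]) (simp add: ann_Nil)
  next
    case (step c s y)
    then obtain ts where ts: "set ts \<subseteq> \<Theta>" "ann ts y = 0" by blast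
    obtain t where t: "t \<in> \<Theta>" "A *v s = t *s s" using S step.hyps by blast
    \<comment> \<open>\<open>ann ts s\<close> is a multiple of \<open>s\<close>, so the new outer
      factor \<open>A - t\<close> removes it.\<close>
    have "ann (t # ts) (c *s s + y) = 0"
      by (simp add: ann_Cons ann_add ts ann_eigen[OF t(2)] vec.scale t(2) mult.commute)
    with ts t show ?case by (intro exI[of _ "t # ts"]) auto
  qed
  then obtain ts where ts: "set ts \<subseteq> \<Theta>" "ann ts x = 0" by blast
  then have "(\<Prod>u\<leftarrow>ts. \<theta> - u) = 0"
    using ann_eigen[OF x(3)] x(2) by simp
  then show ?thesis using ts(1) by (auto simp: prod_list_zero_iff)
qed

text \<open>Nonzero eigenvectors for distinct eigenvalues are independent, and an infinite sequence
  of them would exceed the dimension.\<close>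

lemma eigenvectors_eventually_zero:
  fixes A :: "complex^'d^'d" and x :: "nat \<Rightarrow> complex^'d"
  assumes eig: "\<And>k. A *v x k = \<theta> k *s x k" and inj: "inj \<theta>"
  shows "\<exists>k. x k = 0"
proof (rule ccontr)
  assume "\<nexists>k. x k = 0"
  then have nz: "x k \<noteq> 0" for k by blast
  have notin: "x k \<notin> vec.span (x ` {..<k})" for k
  proof
    assume "x k \<in> vec.span (x ` {..<k})"
    then have "\<theta> k \<in> \<theta> ` {..<k}"
      by (rule eigenvalue_of_span_of_eigenvectors) (use nz eig in auto)
    then show False using inj by (auto dest: injD)
  qed
  have "vec.independent (x ` {..<k}) \<and> card (x ` {..<k}) = k" for k
  proof (induction k)
    case (Suc k)
    then show ?case
      using notin[of k] vec.span_base[of "x k" "x ` {..<k}"]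
      by (auto simp: lessThan_Suc vec.independent_insert)
  qed (simp add: vec.independent_empty)
  from this[of "Suc CARD('d)"] show False
    using vec.independent_card_le_dim[of "x ` {..<Suc CARD('d)}" UNIV] by (simp add: card_cart_basis)
qed

section \<open>Weights and root vectors\<close>

text \<open>The weight \<open>\<kappa>\<close> plus \<open>k\<close> times the root of
  \<open>E_rs\<close>.\<close>

definition shift :: "nat \<Rightarrow> nat \<Rightarrow> nat \<Rightarrow> (nat \<Rightarrow> complex) \<Rightarrow> nat \<Rightarrow> complex" where
  "shift r s k \<kappa> p = \<kappa> p + of_nat k * ((if p = r then 1 else 0) - (if p = s then 1 else 0))"

locale gl_rep =
  fixes m N :: nat and rho :: "nat \<Rightarrow> nat \<Rightarrow> complex^'d^'d"
  assumes rep: "is_gl_rep m N rho"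
begin

definition weight_vector :: "(nat \<Rightarrow> complex) \<Rightarrow> complex^'d \<Rightarrow> bool" where
  "weight_vector \<kappa> x \<longleftrightarrow> (\<forall>p\<in>{1..N}. rho p p *v x = \<kappa> p *s x)"

definition killed :: "(nat \<times> nat) set \<Rightarrow> complex^'d \<Rightarrow> bool" where
  "killed K x \<longleftrightarrow> (\<forall>(p, q)\<in>K. rho p q *v x = 0)"

abbreviation pow :: "nat \<Rightarrow> nat \<Rightarrow> nat \<Rightarrow> complex^'d \<Rightarrow> complex^'d" where
  "pow r s k \<equiv> ((*v) (rho r s)) ^^ k"

lemma rho_rho:
  assumes "p \<in> {1..N}" "q \<in> {1..N}" "r \<in> {1..N}" "s \<in> {1..N}"
  shows "rho p q *v (rho r s *v x) = ssign m p q r s *s (rho r s *v (rho p q *v x))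
    + (if q = r then rho p s *v x else 0) - ssign m p q r s *s (if p = s then rho r q *v x else 0)"
proof -
  have move: "a = b + c - d" if "a - b = c - d" for a b c d :: "complex^'d"
    using that by (simp add: algebra_simps)
  show ?thesis by (rule move) (use rep assms in \<open>unfold is_gl_rep_def, blast\<close>)
qed

lemma ssign_diag: "ssign m p p r s = 1"
  by (simp add: ssign_def mult_2[symmetric] power_mult)

lemma weight_vector_rho:
  assumes "weight_vector \<kappa> x" "r \<in> {1..N}" "s \<in> {1..N}"
  shows "weight_vector (shift r s 1 \<kappa>) (rho r s *v x)"
  unfolding weight_vector_def
proof
  fix p assume p: "p \<in> {1..N}"
  have "rho p p *v x = \<kappa> p *s x" using assms p by (simp add: weight_vector_def)
  then show "rho p p *v (rho r s *v x) = shift r s 1 \<kappa> p *s (rho r s *v x)"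
    using p by (simp add: rho_rho[OF p p assms(2,3)] ssign_diag shift_def vec.scale
      vec.scale_left_distrib vec.scale_left_diff_distrib)
qed

lemma weight_vector_pow:
  assumes "weight_vector \<kappa> x" "r \<in> {1..N}" "s \<in> {1..N}"
  shows "weight_vector (shift r s k \<kappa>) (pow r s k x)"
proof (induction k)
  case 0
  then show ?case using assms by (simp add: shift_def weight_vector_def)
next
  case (Suc k)
  have "shift r s 1 (shift r s k \<kappa>) = shift r s (Suc k) \<kappa>"
    by (auto simp: shift_def algebra_simps)
  then show ?case using weight_vector_rho[OF Suc assms(2,3)] by simp
qed

lemma weight_unique:
  assumes "weight_vector \<kappa> x" "weight_vector \<kappa>' x" "x \<noteq> 0" "p \<in> {1..N}"
  shows "\<kappa> p = \<kappa>' p"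
  using assms by (metis weight_vector_def vec.scale_cancel_right)

text \<open>Moving \<open>E_pq\<close> past \<open>E_rs\<close> produces, besides a term that
  already vanishes, only \<open>E_ps\<close> and \<open>E_rq\<close>, which \<open>c1\<close> and
  \<open>c2\<close> put back into \<open>K\<close>.\<close>

lemma killed_rho:
  assumes K: "K \<subseteq> {1..N} \<times> {1..N}" and rs: "r \<in> {1..N}" "s \<in> {1..N}"
    and c1: "\<And>p. (p, r) \<in> K \<Longrightarrow> (p, s) \<in> K" and c2: "\<And>q. (s, q) \<in> K \<Longrightarrow> (r, q) \<in> K"
    and x: "killed K x"
  shows "killed K (rho r s *v x)"
  unfolding killed_def
proof clarify
  fix p q assume pq: "(p, q) \<in> K"
  then have N: "p \<in> {1..N}" "q \<in> {1..N}" using K by auto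
  have "rho p q *v x = 0" "(if q = r then rho p s *v x else 0) = 0"
    "(if p = s then rho r q *v x else 0) = 0"
    using x c1 c2 pq by (auto simp: killed_def)
  then show "rho p q *v (rho r s *v x) = 0"
    unfolding rho_rho[OF N rs] by (simp only:) simp
qed

text \<open>The condition on \<open>K\<close> says that bracketing with the root vector \<open>E\<^sub>r\<^sub>s\<close> preserves
  the span of the root vectors indexed by \<open>K\<close>.\<close>
lemma exhaust_root:
  assumes K: "K \<subseteq> {1..N} \<times> {1..N}" and rs: "r \<in> {1..N}" "s \<in> {1..N}" "r \<noteq> s"
    and c: "\<And>p. (p, r) \<in> K \<Longrightarrow> (p, s) \<in> K" "\<And>q. (s, q) \<in> K \<Longrightarrow> (r, q) \<in> K"
    and x: "killed K x" "x \<noteq> 0" "weight_vector \<kappa> x"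
  obtains k where "pow r s k x \<noteq> 0" "killed (insert (r, s) K) (pow r s k x)"
    "weight_vector (shift r s k \<kappa>) (pow r s k x)" "par m r \<noteq> par m s \<Longrightarrow> k \<le> 1"
proof -
  have "\<exists>k. pow r s k x = 0"
  \<comment> \<open>Each application of \<open>E_rs\<close> raises the eigenvalue of
    \<open>E_rr\<close> by 1, so the powers have distinct eigenvalues.\<close>
  proof (rule eigenvectors_eventually_zero[where A = "rho r r" and \<theta> = "\<lambda>k. \<kappa> r + of_nat k"])
    show "rho r r *v pow r s k x = (\<kappa> r + of_nat k) *s pow r s k x" for k
      using weight_vector_pow[OF x(3) rs(1,2), of k] rs by (simp add: weight_vector_def shift_def)
  qed (auto simp: inj_def)
  define l where "l = (LEAST k. pow r s k x = 0)"
  have l: "pow r s l x = 0" unfolding l_def by (rule LeastI_ex) fact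
  then obtain k where k: "l = Suc k" using x(2) by (cases l) auto
  have nz: "pow r s k x \<noteq> 0" using not_less_Least[of k "\<lambda>k. pow r s k x = 0"] k l_def by auto
  have "killed K (pow r s j x)" for j
    by (induction j) (use killed_rho[OF K rs(1,2) c] x in auto)
  then have "killed (insert (r, s) K) (pow r s k x)" using l k by (simp add: killed_def)
  moreover have "k \<le> 1" if odd: "par m r \<noteq> par m s"
  proof (rule ccontr)
    assume "\<not> k \<le> 1"
    then obtain j where j: "k = Suc (Suc j)" by (cases k; cases "k - 1") auto
    \<comment> \<open>For an odd root the bracket of \<open>E_rs\<close> with itself is an
      anticommutator, hence \<open>2 E_rs E_rs = 0\<close>.\<close>
    have "ssign m r s r s = -1" using odd by (auto simp: ssign_def par_def split: if_splits)
    then have "rho r s *v (rho r s *v y) = - (rho r s *v (rho r s *v y))" for y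
      using rho_rho[OF rs(1,2,1,2), of y] rs(3) by simp
    then have "rho r s *v (rho r s *v y) = 0" for y
      by (simp add: eq_neg_iff_add_eq_0 vec_eq_iff)
    then show False using nz j by simp
  qed
  ultimately show ?thesis using that nz weight_vector_pow[OF x(3) rs(1,2)] by blast
qed

text \<open>Hence exhausting \<open>E\<^sub>r\<^sub>s\<close> on a vector killed by \<open>E\<^sub>s\<^sub>r\<close> exchanges the components \<open>r\<close> and \<open>s\<close>
  of its weight.\<close>
lemma reflection_exponent:
  assumes rs: "r \<in> {1..N}" "s \<in> {1..N}" "r \<noteq> s" "par m r = par m s"
    and x: "weight_vector \<kappa> x" "rho s r *v x = 0"
    and k: "pow r s k x \<noteq> 0" "rho r s *v pow r s k x = 0"
  shows "of_nat k = \<kappa> s - \<kappa> r"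
proof -
  have sg: "ssign m s r r s = 1" using rs(4) by (simp add: ssign_def mult_2[symmetric] power_mult)
  have step: "rho s r *v (rho r s *v y) = rho r s *v (rho s r *v y) + rho s s *v y - rho r r *v y" for y
    using rho_rho[OF rs(2,1,1,2), of y] sg by simp
  have w: "rho r r *v pow r s j x = (\<kappa> r + of_nat j) *s pow r s j x"
    "rho s s *v pow r s j x = (\<kappa> s - of_nat j) *s pow r s j x" for j
    using weight_vector_pow[OF x(1) rs(1,2), of j] rs by (simp_all add: weight_vector_def shift_def)
  \<comment> \<open>The string formula of \<open>sl_2\<close>, with \<open>E_sr\<close> annihilating
    the starting vector.\<close>
  have "rho s r *v pow r s (Suc j) x = (of_nat (Suc j) * (\<kappa> s - \<kappa> r - of_nat j)) *s pow r s j x" for j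
  proof (induction j)
    case 0
    show ?case using w[of 0] x(2) step[of x] by (simp add: vec.scale_left_diff_distrib)
  next
    case (Suc j)
    have "rho s r *v pow r s (Suc (Suc j)) x
      = (of_nat (Suc j) * (\<kappa> s - \<kappa> r - of_nat j)) *s pow r s (Suc j) x
        + (\<kappa> s - of_nat (Suc j)) *s pow r s (Suc j) x - (\<kappa> r + of_nat (Suc j)) *s pow r s (Suc j) x"
      using step[of "pow r s (Suc j) x"] Suc w[of "Suc j"] by (simp add: vec.scale)
    also have "\<dots> = (of_nat (Suc (Suc j)) * (\<kappa> s - \<kappa> r - of_nat (Suc j))) *s pow r s (Suc j) x"
      unfolding vec.scale_left_distrib[symmetric] vec.scale_left_diff_distrib[symmetric]
      by (rule arg_cong[where f = "\<lambda>c. c *s pow r s (Suc j) x"]) (simp add: algebra_simps)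
    finally show ?case .
  qed
  \<comment> \<open>At the last nonzero power the left side of the formula is 0.\<close>
  from this[of k] have "of_nat (Suc k) * (\<kappa> s - \<kappa> r - of_nat k) = 0"
    using k by simp
  then show ?thesis by (metis eq_iff_diff_eq_0 mult_eq_0_iff of_nat_neq_0)
qed

section \<open>Uniqueness of the highest weight vector\<close>

text \<open>For a highest weight vector \<open>v\<close>, the span of this set is the submodule
  generated by \<open>v\<close>.\<close>

inductive_set lowered :: "complex^'d \<Rightarrow> (complex^'d) set" for v where
  start: "v \<in> lowered v"
| lower: "\<lbrakk>x \<in> lowered v; p \<in> {1..N}; q \<in> {1..N}; p < q\<rbrakk> \<Longrightarrow> rho q p *v x \<in> lowered v"

lemma span_lowered_invariant:
  assumes v: "highest_weight_vector N rho \<kappa> v"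
    and x: "x \<in> vec.span (lowered v)" and rs: "r \<in> {1..N}" "s \<in> {1..N}"
  shows "rho r s *v x \<in> vec.span (lowered v)"
proof -
  let ?W = "vec.span (lowered v)"
  have W_lower: "rho q p *v y \<in> ?W" if "y \<in> ?W" "p \<in> {1..N}" "q \<in> {1..N}" "p < q" for y p q
    using that(1)
  proof (induction rule: vec.span_induct_alt)
    case (step c z y)
    then show ?case using that
      by (simp add: vec.add vec.scale vec.span_add vec.span_scale vec.span_base lowered.lower)
  qed (simp add: vec.span_zero)
  \<comment> \<open>All \<open>r\<close>, \<open>s\<close> are treated at once, since moving
    \<open>E_rs\<close> past \<open>E_qp\<close> leaves \<open>E_rp\<close> and \<open>E_qs\<close>
    acting on the shorter word.\<close>
  have gen: "\<forall>r\<in>{1..N}. \<forall>s\<in>{1..N}. rho r s *v y \<in> ?W" if "y \<in> lowered v" for y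
    using that
  proof induction
    case start
    show ?case
    proof (intro ballI)
      fix r s assume rs: "r \<in> {1..N}" "s \<in> {1..N}"
      have vW: "v \<in> ?W" by (simp add: vec.span_base lowered.start)
      consider "r < s" | "r = s" | "s < r" by linarith
      then show "rho r s *v v \<in> ?W"
      proof cases
        case 1
        then have "rho r s *v v = 0" using v rs unfolding highest_weight_vector_def by blast
        then show ?thesis by (simp add: vec.span_zero)
      next
        case 2
        then have "rho r s *v v = \<kappa> r *s v" using v rs unfolding highest_weight_vector_def by blast
        then show ?thesis by (simp add: vec.span_scale vW)
      next
        case 3
        then show ?thesis using W_lower[OF vW] rs by blast
      qed
    qed
  next
    case (lower y p q)
    show ?case
    proof (intro ballI)
      fix r s assume rs: "r \<in> {1..N}" "s \<in> {1..N}"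
      have "rho q p *v (rho r s *v y) \<in> ?W"
        using W_lower lower rs by blast
      moreover have "rho r p *v y \<in> ?W" "rho q s *v y \<in> ?W" using lower rs by blast+
      ultimately show "rho r s *v (rho q p *v y) \<in> ?W"
        unfolding rho_rho[OF rs lower.hyps(3,2)]
        by (intro vec.span_diff vec.span_add vec.span_scale) (simp_all add: vec.span_zero)
    qed
  qed
  show ?thesis using x
  proof (induction rule: vec.span_induct_alt)
    case (step c z y)
    then show ?case using gen[of z] rs by (simp add: vec.add vec.scale vec.span_add vec.span_scale)
  qed (simp add: vec.span_zero)
qed

text \<open>Every lowering operator increases the eigenvalue of \<open>\<Sum>p. p E\<^sub>p\<^sub>p\<close> by a positive integer.\<close>
definition height_op :: "complex^'d^'d" where
  "height_op = matrix (\<lambda>x. \<Sum>p\<in>{1..N}. of_nat p *s (rho p p *v x))"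

lemma height_op_weight:
  assumes "weight_vector \<kappa> x"
  shows "height_op *v x = (\<Sum>p\<in>{1..N}. of_nat p * \<kappa> p) *s x"
proof -
  have "Vector_Spaces.linear (*s) (*s) (\<lambda>x. \<Sum>p\<in>{1..N}. of_nat p *s (rho p p *v x))"
    by (intro vec.linear_compose_sum ballI vec.linear_compose_scale_right matrix_vector_mul_linear_gen)
  then have "height_op *v x = (\<Sum>p\<in>{1..N}. of_nat p *s (rho p p *v x))"
    unfolding height_op_def by (rule matrix_works)
  also have "\<dots> = (\<Sum>p\<in>{1..N}. (of_nat p * \<kappa> p) *s x)"
    using assms by (intro sum.cong) (auto simp: weight_vector_def)
  finally show ?thesis by (simp add: vec.scale_sum_left)
qed

lemma height_shift:
  assumes "r \<in> {1..N}" "s \<in> {1..N}"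
  shows "(\<Sum>p\<in>{1..N}. of_nat p * shift r s 1 \<kappa> p)
    = (\<Sum>p\<in>{1..N}. of_nat p * \<kappa> p) + of_nat r - of_nat s"
proof -
  have "of_nat p * shift r s 1 \<kappa> p
    = of_nat p * \<kappa> p + (if p = r then of_nat p else 0) - (if p = s then of_nat p else 0)" for p
    by (simp add: shift_def algebra_simps)
  then show ?thesis using assms by (simp add: sum.distrib sum_subtractf)
qed

lemma lowered_height:
  assumes v: "weight_vector \<kappa> v" and x: "x \<in> lowered v"
  shows "x = v \<or> (\<exists>k>0. height_op *v x = ((\<Sum>p\<in>{1..N}. of_nat p * \<kappa> p) + of_nat k) *s x)"
proof -
  let ?h = "\<lambda>\<kappa>. \<Sum>p\<in>{1..N}. of_nat p * \<kappa> p"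
  have "\<exists>k \<kappa>'. weight_vector \<kappa>' x \<and> ?h \<kappa>' = ?h \<kappa> + of_nat k \<and> (k > 0 \<or> x = v)"
    using x
  proof induction
    case start
    show ?case using v by (intro exI[of _ 0] exI[of _ \<kappa>]) auto
  next
    case (lower x p q)
    then obtain k \<kappa>' where k: "weight_vector \<kappa>' x" "?h \<kappa>' = ?h \<kappa> + of_nat k" by blast
    show ?case
      \<comment> \<open>\<open>E_qp\<close> with \<open>p < q\<close> raises the height by
        \<open>q - p > 0\<close>.\<close>
      by (rule exI[of _ "k + (q - p)"], rule exI[of _ "shift q p 1 \<kappa>'"])
        (use lower k height_shift[of q p \<kappa>'] weight_vector_rho[OF k(1), of q p] in
          \<open>auto simp: of_nat_diff\<close>)
  qed
  then show ?thesis using height_op_weight by metis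
qed

lemma highest_weight_vector_iff:
  "highest_weight_vector N rho \<kappa> v \<longleftrightarrow>
    v \<noteq> 0 \<and> weight_vector \<kappa> v \<and> killed {(p, q). p \<in> {1..N} \<and> q \<in> {1..N} \<and> p < q} v"
  by (auto simp: highest_weight_vector_def weight_vector_def killed_def)

text \<open>By irreducibility each of the two vectors generates everything, so each height is at
  least the other. In \<open>lowered v\<close> every vector except \<open>v\<close> belongs to a
  strictly larger height, so \<open>w\<close> has no component beyond a multiple of
  \<open>v\<close>.\<close>

lemma highest_weight_vector_unique:
  assumes irr: "irreducible_rep N rho"
    and v: "highest_weight_vector N rho \<kappa> v" and w: "highest_weight_vector N rho \<kappa>' w"
  shows "\<exists>c. w = c *s v"
proof -
  let ?h = "\<lambda>\<kappa>. \<Sum>p\<in>{1..N}. of_nat p * \<kappa> p :: complex"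
  have univ: "vec.span (lowered v) = UNIV" if v: "highest_weight_vector N rho \<kappa> v" for \<kappa> v
  proof -
    have "csubspace (vec.span (lowered v))"
      by (auto simp: csubspace_def vec.span_zero vec.span_add vec.span_scale)
    moreover have "v \<in> vec.span (lowered v)" by (simp add: vec.span_base lowered.start)
    ultimately show ?thesis
      using irr span_lowered_invariant[OF v] v
      unfolding irreducible_rep_def highest_weight_vector_def by blast
  qed
  have ge: "\<exists>k. ?h \<kappa>' = ?h \<kappa> + of_nat k"
    if v: "highest_weight_vector N rho \<kappa> v" and w: "highest_weight_vector N rho \<kappa>' w" for \<kappa> \<kappa>' v w
  proof -
    have wv: "weight_vector \<kappa> v" "weight_vector \<kappa>' w" "w \<noteq> 0"
      using v w by (auto simp: highest_weight_vector_iff)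
    have "?h \<kappa>' \<in> range (\<lambda>k. ?h \<kappa> + of_nat k)"
    proof (rule eigenvalue_of_span_of_eigenvectors)
      show "w \<in> vec.span (lowered v)" using univ[OF v] by simp
      show "height_op *v w = ?h \<kappa>' *s w" using height_op_weight wv by blast
      show "\<exists>t\<in>range (\<lambda>k. ?h \<kappa> + of_nat k). height_op *v s = t *s s" if "s \<in> lowered v" for s
        using lowered_height[OF wv(1) that]
      proof
        assume "s = v"
        then show ?thesis using height_op_weight[OF wv(1)] by (intro bexI[of _ "?h \<kappa> + of_nat 0"]) auto
      qed auto
    qed (fact wv)
    then show ?thesis by auto
  qed
  obtain k l where kl: "?h \<kappa>' = ?h \<kappa> + of_nat k" "?h \<kappa> = ?h \<kappa>' + of_nat l"
    using ge[OF v w] ge[OF w v] by blast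
  then have "of_nat (k + l) = (0 :: complex)" by (simp add: algebra_simps)
  then have eq: "?h \<kappa>' = ?h \<kappa>" using kl by (simp only: of_nat_eq_0_iff) simp
  have wv: "weight_vector \<kappa> v" "weight_vector \<kappa>' w"
    using v w by (auto simp: highest_weight_vector_iff)
  define S where "S = lowered v - {v}"
  have "w \<in> vec.span (insert v S)" using univ[OF v] by (simp add: S_def insert_absorb lowered.start)
  then obtain c where c: "w - c *s v \<in> vec.span S" by (auto simp: vec.span_insert)
  have "w - c *s v = 0"
  proof (rule ccontr)
    assume nz: "w - c *s v \<noteq> 0"
    have "?h \<kappa> \<in> (\<lambda>k. ?h \<kappa> + of_nat k) ` {0<..}"
    proof (rule eigenvalue_of_span_of_eigenvectors[OF c nz])
      show "height_op *v (w - c *s v) = ?h \<kappa> *s (w - c *s v)"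
        using height_op_weight[OF wv(1)] height_op_weight[OF wv(2)] eq
        by (simp add: vec.diff vec.scale vec.scale_right_diff_distrib mult.commute)
      show "\<exists>t\<in>(\<lambda>k. ?h \<kappa> + of_nat k) ` {0<..}. height_op *v s = t *s s" if "s \<in> S" for s
        using lowered_height[OF wv(1), of s] that by (auto simp: S_def)
    qed
    then show False by auto
  qed
  then show ?thesis by auto
qed

section \<open>Raising maximal vectors\<close>

text \<open>For \<open>M = m + n\<close> these are the positive roots of
  \<open>gl(m|n)\<close>.\<close>

definition pos :: "nat \<Rightarrow> (nat \<times> nat) set" where
  "pos M = {(p, q). 1 \<le> p \<and> p < q \<and> q \<le> M}"

text \<open>\<open>E_1N\<close> acts first. For fixed exponents \<open>k\<close> the map is linear
  in \<open>x\<close>, on which the uniqueness argument rests.\<close>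

primrec raise :: "(nat \<Rightarrow> nat) \<Rightarrow> nat \<Rightarrow> complex^'d \<Rightarrow> complex^'d" where
  "raise k 0 x = x"
| "raise k (Suc j) x = pow (Suc j) N (k (Suc j)) (raise k j x)"

lemma raise_cong: "(\<And>p. p \<in> {1..j} \<Longrightarrow> k p = k' p) \<Longrightarrow> raise k j x = raise k' j x"
  by (induction j) auto

lemma pow_diff: "pow r s k (a *s x - b *s y) = a *s pow r s k x - b *s pow r s k y"
  by (induction k) (simp_all add: vec.diff vec.scale)

lemma raise_diff: "raise k j (a *s x - b *s y) = a *s raise k j x - b *s raise k j y"
  by (induction j) (simp_all add: pow_diff)

text \<open>Raising with \<open>E\<^sub>1\<^sub>N\<close>, \<open>E\<^sub>2\<^sub>N\<close> and so on in this order keeps the vector maximal, because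
  \<open>[E\<^sub>p\<^sub>q, E\<^sub>q\<^sub>N] = E\<^sub>p\<^sub>N\<close> with \<open>p < q\<close> has already been exhausted.\<close>
lemma raise_maximal:
  assumes N: "N = Suc M" and mM: "m \<le> M"
    and x: "x \<noteq> 0" "killed (pos M) x" "weight_vector \<kappa> x" and "j \<le> M"
  shows "\<exists>k \<kappa>'. raise k j x \<noteq> 0 \<and> killed (pos M \<union> {1..j} \<times> {N}) (raise k j x)
    \<and> weight_vector \<kappa>' (raise k j x)
    \<and> (\<forall>p\<in>{1..j}. \<kappa>' p = \<kappa> p + of_nat (k p) \<and> (p \<le> m \<longrightarrow> k p \<le> 1))
    \<and> (\<forall>p\<in>{j<..M}. \<kappa>' p = \<kappa> p) \<and> \<kappa>' N = \<kappa> N - of_nat (\<Sum>p\<in>{1..j}. k p)"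
  using \<open>j \<le> M\<close>
proof (induction j)
  case 0
  show ?case using x by (intro exI[of _ "\<lambda>_. 0"] exI[of _ \<kappa>]) auto
next
  case (Suc j)
  then obtain k \<kappa>' where k: "raise k j x \<noteq> 0" "killed (pos M \<union> {1..j} \<times> {N}) (raise k j x)"
    "weight_vector \<kappa>' (raise k j x)"
    and \<kappa>': "\<And>p. p \<in> {1..j} \<Longrightarrow> \<kappa>' p = \<kappa> p + of_nat (k p) \<and> (p \<le> m \<longrightarrow> k p \<le> 1)"
    "\<And>p. p \<in> {j<..M} \<Longrightarrow> \<kappa>' p = \<kappa> p" "\<kappa>' N = \<kappa> N - of_nat (\<Sum>p\<in>{1..j}. k p)" by auto
  obtain l where l: "pow (Suc j) N l (raise k j x) \<noteq> 0"
    "killed (insert (Suc j, N) (pos M \<union> {1..j} \<times> {N})) (pow (Suc j) N l (raise k j x))"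
    "weight_vector (shift (Suc j) N l \<kappa>') (pow (Suc j) N l (raise k j x))"
    "par m (Suc j) \<noteq> par m N \<Longrightarrow> l \<le> 1"
    by (rule exhaust_root[of "pos M \<union> {1..j} \<times> {N}" "Suc j" N "raise k j x" \<kappa>'])
      (use Suc.prems N k in \<open>auto simp: pos_def\<close>)
  let ?k = "k(Suc j := l)"
  have eq: "raise ?k (Suc j) x = pow (Suc j) N l (raise k j x)"
    using raise_cong[of j ?k k x] by simp
  have set: "pos M \<union> {1..Suc j} \<times> {N} = insert (Suc j, N) (pos M \<union> {1..j} \<times> {N})"
    by (auto simp: pos_def)
  \<comment> \<open>\<open>N\<close> exceeds \<open>m\<close>, so the root is odd when
    \<open>Suc j \<le> m\<close>.\<close>
  have odd: "Suc j \<le> m \<Longrightarrow> l \<le> 1" using l(4) mM N by (simp add: par_def)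
  have sum: "(\<Sum>p\<in>{1..Suc j}. ?k p) = (\<Sum>p\<in>{1..j}. k p) + l"
    by simp
  show ?case
  proof (intro exI[of _ ?k] exI[of _ "shift (Suc j) N l \<kappa>'"] conjI)
    show "\<forall>p\<in>{1..Suc j}. shift (Suc j) N l \<kappa>' p = \<kappa> p + of_nat (?k p) \<and> (p \<le> m \<longrightarrow> ?k p \<le> 1)"
    proof
      fix p assume "p \<in> {1..Suc j}"
      then consider "p \<in> {1..j}" | "p = Suc j" by (auto simp: le_Suc_eq)
      then show "shift (Suc j) N l \<kappa>' p = \<kappa> p + of_nat (?k p) \<and> (p \<le> m \<longrightarrow> ?k p \<le> 1)"
      proof cases
        case 1
        then show ?thesis using Suc.prems N \<kappa>'(1)[OF 1] by (auto simp: shift_def)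
      next
        case 2
        then show ?thesis using Suc.prems N \<kappa>'(2)[of "Suc j"] odd by (auto simp: shift_def)
      qed
    qed
    show "\<forall>p\<in>{Suc j<..M}. shift (Suc j) N l \<kappa>' p = \<kappa> p"
      using N \<kappa>'(2) by (auto simp: shift_def)
    show "shift (Suc j) N l \<kappa>' N = \<kappa> N - of_nat (\<Sum>p\<in>{1..Suc j}. ?k p)"
      unfolding sum using N \<kappa>'(3) Suc.prems by (simp add: shift_def)
  qed (use l(1-3) in \<open>simp_all only: eq set not_False_eq_True\<close>)
qed

section \<open>Placing \<open>N\<close> directly after \<open>m\<close>, and reflecting back\<close>

text \<open>Descending \<open>q\<close> makes the order work: \<open>[E_Nq, E_qr] = E_Nr\<close>
  with \<open>q < r\<close> is already exhausted, and \<open>[E_pN, E_Nq] = E_pq\<close> with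
  \<open>p \<le> m\<close> is in \<open>pos M\<close>. Each \<open>E_Nq\<close> can only decrease
  component \<open>q\<close>.\<close>

lemma lower_maximal:
  assumes N: "N = Suc M"
    and x: "x \<noteq> 0" "killed (pos M \<union> {1..m} \<times> {N}) x" "weight_vector \<kappa> x" and "d \<le> M - m"
  shows "\<exists>y \<kappa>'. y \<noteq> 0 \<and> killed (pos M \<union> {1..m} \<times> {N} \<union> {N} \<times> {M - d<..M}) y
    \<and> weight_vector \<kappa>' y \<and> (\<forall>p\<in>{m<..M}. \<kappa> p - \<kappa>' p \<in> \<nat>)"
  using \<open>d \<le> M - m\<close>
proof (induction d)
  case 0
  show ?case using x by (intro exI[of _ x] exI[of _ \<kappa>]) auto
next
  case (Suc d)
  let ?K = "pos M \<union> {1..m} \<times> {N} \<union> {N} \<times> {M - d<..M}"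
  obtain y \<kappa>' where y: "y \<noteq> 0" "killed ?K y" "weight_vector \<kappa>' y"
    and \<kappa>': "\<And>p. p \<in> {m<..M} \<Longrightarrow> \<kappa> p - \<kappa>' p \<in> \<nat>" using Suc by auto
  obtain l where l: "pow N (M - d) l y \<noteq> 0"
    "killed (insert (N, M - d) ?K) (pow N (M - d) l y)"
    "weight_vector (shift N (M - d) l \<kappa>') (pow N (M - d) l y)"
    by (rule exhaust_root[of ?K N "M - d" y \<kappa>'])
      (use Suc.prems N y in \<open>auto simp: pos_def\<close>)
  have set: "pos M \<union> {1..m} \<times> {N} \<union> {N} \<times> {M - Suc d<..M} = insert (N, M - d) ?K"
    using Suc.prems by auto
  have "\<kappa> p - shift N (M - d) l \<kappa>' p \<in> \<nat>" if "p \<in> {m<..M}" for p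
  proof -
    have "\<kappa> p - shift N (M - d) l \<kappa>' p = \<kappa> p - \<kappa>' p + of_nat (if p = M - d then l else 0)"
      using that N by (auto simp: shift_def)
    also have "\<dots> \<in> \<nat>" by (intro Nats_add \<kappa>' that of_nat_in_Nats)
    finally show ?thesis .
  qed
  then show ?case using l set by metis
qed

text \<open>Moves \<open>N\<close> through the ordering of the indices by simple reflections, from its place directly
  after \<open>m\<close> to the last place.\<close>
lemma reflect_to_highest:
  assumes N: "N = Suc M"
    and x: "x \<noteq> 0" "killed (pos M \<union> {1..m} \<times> {N} \<union> {N} \<times> {m<..M}) x" "weight_vector a x"
    and "d \<le> M - m"
  shows "\<exists>y \<kappa>. y \<noteq> 0 \<and> killed (pos M \<union> {1..m + d} \<times> {N} \<union> {N} \<times> {m + d<..M}) y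
    \<and> weight_vector \<kappa> y \<and> (\<forall>q. m < q \<and> q < m + d \<longrightarrow> \<kappa> (Suc q) = a q)
    \<and> (d > 0 \<longrightarrow> \<kappa> N = a (m + d)) \<and> (\<forall>q\<in>{m + d<..M}. \<kappa> q = a q)"
  using \<open>d \<le> M - m\<close>
proof (induction d)
  case 0
  show ?case using x by (intro exI[of _ x] exI[of _ a]) auto
next
  case (Suc d)
  obtain y \<kappa> where y: "y \<noteq> 0" "killed (pos M \<union> {1..m + d} \<times> {N} \<union> {N} \<times> {m + d<..M}) y"
    "weight_vector \<kappa> y"
    and \<kappa>: "\<And>q. m < q \<Longrightarrow> q < m + d \<Longrightarrow> \<kappa> (Suc q) = a q" "d > 0 \<Longrightarrow> \<kappa> N = a (m + d)"
    "\<And>q. q \<in> {m + d<..M} \<Longrightarrow> \<kappa> q = a q" using Suc by auto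
  let ?j = "Suc (m + d)"
  \<comment> \<open>\<open>(N, ?j)\<close> is dropped, as bracketing \<open>E_N?j\<close> with
    \<open>E_?jN\<close> would leave the span; \<open>(?j, N)\<close> takes its place below.\<close>
  let ?K = "pos M \<union> {1..m + d} \<times> {N} \<union> {N} \<times> {?j<..M}"
  have j: "?j \<in> {1..N}" "N \<in> {1..N}" "?j \<noteq> N" "?j \<le> M" using N Suc.prems by auto
  have yK: "killed ?K y" using y(2) by (auto simp: killed_def)
  obtain l where l: "pow ?j N l y \<noteq> 0"
    "killed (insert (?j, N) ?K) (pow ?j N l y)"
    "weight_vector (shift ?j N l \<kappa>) (pow ?j N l y)"
    by (rule exhaust_root[of ?K ?j N y \<kappa>])
      (use j N y yK in \<open>auto simp: pos_def\<close>)
  have "rho N ?j *v y = 0" "rho ?j N *v pow ?j N l y = 0"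
    using y(2) l(2) j by (auto simp: killed_def)
  \<comment> \<open>Both indices exceed \<open>m\<close>, so the root is even. With this exponent
    components \<open>?j\<close> and \<open>N\<close> trade values: \<open>?j\<close> receives the
    entry carried by \<open>N\<close>, which picks up \<open>a ?j\<close>.\<close>
  then have ll: "of_nat l = \<kappa> N - \<kappa> ?j"
    using reflection_exponent[OF j(1-3) _ y(3)] l(1) N j by (simp add: par_def)
  have set: "pos M \<union> {1..m + Suc d} \<times> {N} \<union> {N} \<times> {m + Suc d<..M} = insert (?j, N) ?K"
    by auto
  show ?case
  proof (intro exI[of _ "pow ?j N l y"] exI[of _ "shift ?j N l \<kappa>"] conjI)
    show "\<forall>q. m < q \<and> q < m + Suc d \<longrightarrow> shift ?j N l \<kappa> (Suc q) = a q"
      using \<kappa>(1,2) ll j by (auto simp: shift_def less_Suc_eq)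
    show "0 < Suc d \<longrightarrow> shift ?j N l \<kappa> N = a (m + Suc d)"
      using \<kappa>(3)[of ?j] ll j by (simp add: shift_def)
    show "\<forall>q\<in>{m + Suc d<..M}. shift ?j N l \<kappa> q = a q"
      using \<kappa>(3) N by (auto simp: shift_def)
  qed (use l set in auto)
qed

section \<open>Comparison with the highest weight\<close>

lemma highest_of_killed:
  assumes "N = Suc M" "x \<noteq> 0" "weight_vector \<kappa> x" "killed (pos M \<union> {1..M} \<times> {N}) x"
  shows "highest_weight_vector N rho \<kappa> x"
proof -
  have "{(p, q). p \<in> {1..N} \<and> q \<in> {1..N} \<and> p < q} \<subseteq> pos M \<union> {1..M} \<times> {N}"
    using assms(1) by (auto simp: pos_def le_Suc_eq)
  then show ?thesis using assms(2-4) by (auto simp: highest_weight_vector_iff killed_def)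
qed

lemma highest_weight_unique:
  assumes irr: "irreducible_rep N rho"
    and v: "highest_weight_vector N rho \<kappa> v" and w: "highest_weight_vector N rho \<kappa>' w"
    and p: "p \<in> {1..N}"
  shows "\<kappa> p = \<kappa>' p"
proof -
  obtain c where c: "w = c *s v" using highest_weight_vector_unique[OF irr v w] by blast
  have "weight_vector \<kappa> w"
    using v c by (simp add: highest_weight_vector_iff weight_vector_def vec.scale mult.commute)
  then show ?thesis using weight_unique[of \<kappa> w \<kappa>'] w p by (simp add: highest_weight_vector_iff)
qed

text \<open>The raised vector is a highest weight vector, so its weight must be
  \<open>\<nu>\<close>; this forces the exponents to be differences of weight components.\<close>

lemma raise_to_highest:
  assumes N: "N = Suc M" and mM: "m \<le> M" and irr: "irreducible_rep N rho"
    and v: "highest_weight_vector N rho \<nu> v"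
    and x: "x \<noteq> 0" "killed (pos M) x" "weight_vector \<kappa> x"
  obtains k where "highest_weight_vector N rho \<nu> (raise k M x)"
    "\<And>p. p \<in> {1..M} \<Longrightarrow> \<nu> p = \<kappa> p + of_nat (k p)" "\<And>p. p \<in> {1..m} \<Longrightarrow> k p \<le> 1"
    "\<nu> N = \<kappa> N - of_nat (\<Sum>p\<in>{1..M}. k p)"
proof -
  obtain k \<kappa>' where k: "raise k M x \<noteq> 0" "killed (pos M \<union> {1..M} \<times> {N}) (raise k M x)"
    "weight_vector \<kappa>' (raise k M x)"
    and \<kappa>': "\<And>p. p \<in> {1..M} \<Longrightarrow> \<kappa>' p = \<kappa> p + of_nat (k p) \<and> (p \<le> m \<longrightarrow> k p \<le> 1)"
    "\<kappa>' N = \<kappa> N - of_nat (\<Sum>p\<in>{1..M}. k p)"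
    using raise_maximal[OF N mM x, of M] by auto
  have hw: "highest_weight_vector N rho \<kappa>' (raise k M x)"
    using highest_of_killed[OF N] k by blast
  have eq: "\<nu> p = \<kappa>' p" if "p \<in> {1..N}" for p
    by (rule highest_weight_unique[OF irr v hw that])
  then have "highest_weight_vector N rho \<nu> (raise k M x)"
    using hw by (simp add: highest_weight_vector_def)
  then show ?thesis
    by (rule that) (use eq \<kappa>' N mM in auto)
qed

text \<open>Odd raising leaves component \<open>q > m\<close> unchanged, lowering decreases it to
  \<open>a q\<close>, and the cyclic shift carries \<open>a q\<close> to position
  \<open>Suc q\<close> of the highest weight.\<close>

lemma lower_betweenness:
  assumes N: "N = Suc M" and mM: "m \<le> M" and irr: "irreducible_rep N rho"
    and v: "highest_weight_vector N rho \<nu> v"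
    and x: "x \<noteq> 0" "killed (pos M) x" "weight_vector \<kappa> x" and q: "q \<in> {m<..M}"
  shows "\<kappa> q - \<nu> (Suc q) \<in> \<nat>"
proof -
  obtain k \<kappa>1 where 1: "raise k m x \<noteq> 0" "killed (pos M \<union> {1..m} \<times> {N}) (raise k m x)"
    "weight_vector \<kappa>1 (raise k m x)" "\<And>p. p \<in> {m<..M} \<Longrightarrow> \<kappa>1 p = \<kappa> p"
    using raise_maximal[OF N mM x mM] by blast
  obtain y a where 2: "y \<noteq> 0" "killed (pos M \<union> {1..m} \<times> {N} \<union> {N} \<times> {m<..M}) y"
    "weight_vector a y" "\<And>p. p \<in> {m<..M} \<Longrightarrow> \<kappa>1 p - a p \<in> \<nat>"
    using lower_maximal[OF N 1(1-3), of "M - m"] mM by auto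
  obtain z \<kappa>' where 3: "z \<noteq> 0" "killed (pos M \<union> {1..M} \<times> {N}) z" "weight_vector \<kappa>' z"
    "\<And>q. m < q \<Longrightarrow> q < M \<Longrightarrow> \<kappa>' (Suc q) = a q" "m < M \<Longrightarrow> \<kappa>' N = a M"
    using reflect_to_highest[OF N 2(1-3), of "M - m"] mM by auto
  have "\<nu> (Suc q) = \<kappa>' (Suc q)"
    using highest_weight_unique[OF irr v highest_of_killed[OF N 3(1,3,2)]] q N by auto
  \<comment> \<open>For \<open>q = M\<close> the target position is \<open>N\<close> itself.\<close>
  also have "\<dots> = a q" using 3(4,5) q N by (cases "q = M") auto
  finally show ?thesis using 1(4)[OF q] 2(4)[OF q] by simp
qed

end

theorem theorem2:
  fixes m n :: nat
    and rho :: "nat \<Rightarrow> nat \<Rightarrow> complex^'d^'d"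
    and Lt Lam :: "nat \<Rightarrow> complex"
    and vplus :: "complex^'d"
  assumes rep: "is_gl_rep m (m + n + 1) rho"
    and irr: "irreducible_rep (m + n + 1) rho"
    and hw: "\<exists>v. highest_weight_vector (m + n + 1) rho Lt v"
    and vp: "L_maximal_of_weight m n rho Lam vplus"
  shows "(\<forall>\<mu>\<in>{1..n}. cge (Lt (m + \<mu>)) (Lam (m + \<mu>)) \<and> cge (Lam (m + \<mu>)) (Lt (m + \<mu> + 1)))
       \<and> (\<forall>i\<in>{1..m}. cge (Lt i) (Lam i) \<and> cge (Lam i) (Lt i - 1))
       \<and> (\<forall>w. L_maximal_of_weight m n rho Lam w \<longrightarrow> (\<exists>c. w = c *s vplus))"
proof -
  interpret gl_rep m "m + n + 1" rho by unfold_locales (fact rep)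
  let ?M = "m + n"
  have N: "m + n + 1 = Suc ?M" and mM: "m \<le> ?M" by simp_all
  obtain v where v: "highest_weight_vector (m + n + 1) rho Lt v" using hw by blast
  \<comment> \<open>\<open>Lam\<close> prescribes only the \<open>gl(m|n)\<close> part of the
    weight; the eigenvalue of the last diagonal element is adjoined as an unknown
    \<open>c\<close>.\<close>
  have L_maximal: "\<exists>c. weight_vector (Lam(m + n + 1 := c)) w" "killed (pos ?M) w" "w \<noteq> 0"
    if w: "L_maximal_of_weight m n rho Lam w" for w
  proof -
    obtain c where "rho (m + n + 1) (m + n + 1) *v w = c *s w"
      using w unfolding L_maximal_of_weight_def by (metis atLeastAtMost_iff le_add2 order_refl)
    then have "weight_vector (Lam(m + n + 1 := c)) w"
      using w unfolding weight_vector_def L_maximal_of_weight_def by (auto simp: le_Suc_eq)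
    then show "\<exists>c. weight_vector (Lam(m + n + 1 := c)) w" by blast
    show "killed (pos ?M) w" "w \<noteq> 0"
      using w by (auto simp: killed_def pos_def L_maximal_of_weight_def)
  qed
  obtain c where c: "weight_vector (Lam(m + n + 1 := c)) vplus" using L_maximal(1)[OF vp] by blast
  obtain k where k: "highest_weight_vector (m + n + 1) rho Lt (raise k ?M vplus)"
    "\<And>p. p \<in> {1..?M} \<Longrightarrow> Lt p = (Lam(m + n + 1 := c)) p + of_nat (k p)"
    "\<And>p. p \<in> {1..m} \<Longrightarrow> k p \<le> 1"
    "Lt (m + n + 1) = (Lam(m + n + 1 := c)) (m + n + 1) - of_nat (\<Sum>p\<in>{1..?M}. k p)"
    using raise_to_highest[OF N mM irr v L_maximal(3,2)[OF vp] c] by metis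
  have Lt: "Lt p = Lam p + of_nat (k p)" if "p \<in> {1..?M}" for p
    using k(2)[OF that] that by auto
  have upper: "cge (Lt p) (Lam p)" if "p \<in> {1..?M}" for p
    using Lt[OF that] by (simp add: cge_def)
  have lower: "cge (Lam (m + \<mu>)) (Lt (m + \<mu> + 1))" if "\<mu> \<in> {1..n}" for \<mu>
    using lower_betweenness[OF N mM irr v L_maximal(3,2)[OF vp] c, of "m + \<mu>"] that
    by (simp add: cge_def split: if_splits)
  have odd: "cge (Lam i) (Lt i - 1)" if i: "i \<in> {1..m}" for i
  proof -
    \<comment> \<open>The truncated difference is exact because \<open>k i \<le> 1\<close>.\<close>
    have "Lam i - (Lt i - 1) = of_nat (1 - k i)" using Lt[of i] k(3)[OF i] i by (simp add: of_nat_diff)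
    then show ?thesis unfolding cge_def by (simp only: of_nat_in_Nats)
  qed
  have unique: "\<exists>a. w = a *s vplus" if w: "L_maximal_of_weight m n rho Lam w" for w
  proof -
    obtain c' where c': "weight_vector (Lam(m + n + 1 := c')) w" using L_maximal(1)[OF w] by blast
    \<comment> \<open>The exponents are the differences of \<open>Lt\<close> and \<open>Lam\<close>,
      so the \<open>k\<close> obtained from \<open>vplus\<close> serves every maximal vector of this
      weight.\<close>
    have same: "highest_weight_vector (m + n + 1) rho Lt (raise k ?M u)
        \<and> Lt (m + n + 1) = e - of_nat (\<Sum>p\<in>{1..?M}. k p)"
      if u: "u \<noteq> 0" "killed (pos ?M) u" "weight_vector (Lam(m + n + 1 := e)) u" for u e
    proof -
      obtain k' where k': "highest_weight_vector (m + n + 1) rho Lt (raise k' ?M u)"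
        "\<And>p. p \<in> {1..?M} \<Longrightarrow> Lt p = (Lam(m + n + 1 := e)) p + of_nat (k' p)"
        "Lt (m + n + 1) = (Lam(m + n + 1 := e)) (m + n + 1) - of_nat (\<Sum>p\<in>{1..?M}. k' p)"
        using raise_to_highest[OF N mM irr v u] by metis
      have eq: "k' p = k p" if "p \<in> {1..?M}" for p
        using k'(2)[OF that] Lt[OF that] that by auto
      then have "(\<Sum>p\<in>{1..?M}. k' p) = (\<Sum>p\<in>{1..?M}. k p)" by (rule sum.cong[OF refl])
      moreover have "raise k' ?M u = raise k ?M u" using eq by (rule raise_cong)
      ultimately show ?thesis using k'(1,3) by simp
    qed
    \<comment> \<open>The last component of \<open>Lt\<close> and the common exponents determine the
      adjoined eigenvalue.\<close>
    have cc: "c' = c" using same[OF L_maximal(3,2)[OF w] c'] k(4) by simp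
    obtain b where b: "raise k ?M w = b *s raise k ?M vplus"
      using highest_weight_vector_unique[OF irr k(1)] same[OF L_maximal(3,2)[OF w] c'] by blast
    let ?u = "1 *s w - b *s vplus"
    have "raise k ?M ?u = 0" unfolding raise_diff b by simp
    moreover have "killed (pos ?M) ?u"
      using L_maximal(2)[OF w] L_maximal(2)[OF vp] by (fastforce simp: killed_def vec.diff vec.scale)
    moreover have "weight_vector (Lam(m + n + 1 := c)) ?u"
      using c c' unfolding cc weight_vector_def
      by (simp add: vec.diff vec.scale vec.scale_right_diff_distrib mult.commute)
    \<comment> \<open>Were \<open>?u\<close> nonzero, \<open>same\<close> would make its image a
      highest weight vector, yet that image is 0.\<close>
    ultimately have "?u = 0" using same[of ?u c] by (auto simp: highest_weight_vector_def)
    then show ?thesis by auto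
  qed
  show ?thesis using upper lower odd unique by auto
qed

end
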